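(* Let $f:\mathbb{R}^N\to\mathbb{R}$ be convex and differentiable, let $\psi(x)=\sum_{i=1}^n\psi^i(x^i)$ with each $\psi^i:\mathbb{R}^{N_i}\to\mathbb{R}\cup\{+\infty\}$ convex and closed, and let $F=f+\psi$. Let $\hat S$ be an arbitrary proper sampling with probability vector $p=(p_1,\dots,p_n)$ and let $v\in\mathbb{R}^n_{++}$ be such that $(f,\hat S)\sim ESO(v)$. Let $\{\theta_k\}_{k\ge0}$ be an arbitrary sequence of positive numbers in $(0,1]$ and fix $y\in\mathbb{R}^N$. Then for the sequence of iterates produced by the ALPHA algorithm and all $k\ge0$, $$\mathbf{E}_k\Big[\hat F_{k+1}+\frac{\theta_k^2}{2}\|z_{k+1}-y\|^2_{v\circ p^{-2}}\Big]\le\Big[\hat F_k+\frac{\theta_k^2}{2}\|z_k-y\|^2_{v\circ p^{-2}}\Big]-\theta_k\big(\hat F_k-F(y)\big).$$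
   Context: Block structure: $\mathbb{R}^N=\mathbb{R}^{N_1}\times\dots\times\mathbb{R}^{N_n}$, $[n]=\{1,\dots,n\}$; $x^i\in\mathbb{R}^{N_i}$ is the $i$th block of $x\in\mathbb{R}^N$, and $U_i$ is the $N\times N_i$ column submatrix of the identity with $x^i=U_i^\top x$. For $S\subseteq[n]$, $h_{[S]}=\sum_{i\in S}U_ih^i$. $\nabla_i f(x)=U_i^\top\nabla f(x)$. $\langle\cdot,\cdot\rangle$ is the standard inner product. For each $i$, $B_i$ is a fixed (symmetric) positive definite $N_i\times N_i$ matrix and $\|x^i\|_i^2=\langle B_ix^i,x^i\rangle$. For $w\in\mathbb{R}^n_{++}$ (vectors with positive entries): $\langle x,y\rangle_w=\sum_i w_i\langle x^i,y^i\rangle$ and $\|x\|_w^2=\sum_i w_i\|x^i\|_i^2$. For vectors in $\mathbb{R}^n$: $\circ$ is the elementwise product, and $p^{-1},p^{-2}$ are elementwise powers. For $u\in\mathbb{R}^n$, $x\in\mathbb{R}^N$: $u\cdot x=\sum_i u_iU_ix^i$. $\mathrm{dom}\,\psi=\{x:\psi(x)<+\infty\}$. Sampling: a sampling $\hat S$ is a random subset of $[n]$; $p_i=\mathrm{Prob}(i\in\hat S)$; it is proper if $p_i>0$ for all $i$. ESO: $(f,\hat S)\sim ESO(v)$ means that for all $x,h\in\mathbb{R}^N$, $\mathbf{E}[f(x+h_{[\hat S]})]\le f(x)+\langle\nabla f(x),h\rangle_p+\frac12\|h\|^2_{v\circ p}$. ALPHA algorithm (parameters $\hat S,v,\{\theta_k\}_{k\ge0}$):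 choose $x_0\in\mathrm{dom}\,\psi$, set $z_0=x_0$. For $k\ge0$: $y_k=(1-\theta_k)x_k+\theta_kz_k$; draw a random set $S_k$ with the distribution of $\hat S$, independently of the past; set $z_{k+1}^i=\arg\min_{z\in\mathbb{R}^{N_i}}\{\langle\nabla_if(y_k),z\rangle+\frac{\theta_kv_i}{2p_i}\|z-z_k^i\|_i^2+\psi^i(z)\}$ for $i\in S_k$ and $z_{k+1}^i=z_k^i$ for $i\notin S_k$; set $x_{k+1}=y_k+\theta_kp^{-1}\cdot(z_{k+1}-z_k)$. $\mathbf{E}_k$ denotes expectation conditional on $S_0,\dots,S_{k-1}$ (i.e. over the draw of $S_k$ only). Coefficients: for each $i\in[n]$, $\gamma^i_{0,0}=1$, $\gamma^i_{1,0}=1-\theta_0p_i^{-1}$, $\gamma^i_{1,1}=\theta_0p_i^{-1}$, and for $k\ge1$: $\gamma^i_{k+1,l}=(1-\theta_k)\gamma^i_{k,l}$ for $l=0,\dots,k-1$; $\gamma^i_{k+1,k}=(1-\theta_k)\gamma^i_{k,k}+\theta_k-\theta_kp_i^{-1}$; $\gamma^i_{k+1,k+1}=\theta_kp_i^{-1}$. Define $\hat\psi^i_k=\sum_{l=0}^k\gamma^i_{k,l}\psi^i(z_l^i)$, $\hat\psi_k=\sum_{i=1}^n\hat\psi_k^i$, and $\hat F_k=\hat\psi_k+f(x_k)$. *)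

theory Defs
  imports "HOL-Probability.Probability"
begin

text \<open>
  The coordinates of \<open>\<real>\<^sup>N\<close> are indexed by a finite type \<open>'m\<close>, the blocks by a finite type \<open>'n\<close>, and
  \<open>b :: 'm \<Rightarrow> 'n\<close> sends a coordinate to its block, so that the dimension of block \<open>i\<close> is
  \<open>card {j. b j = i}\<close>. Since the block dimensions vary with \<open>i\<close>, the \<open>i\<close>-th factor is represented by
  its image under the isometric embedding \<open>U\<^sub>i\<close>, i.e. by the vectors supported on block \<open>i\<close>.
  Accordingly, \<open>block b i x\<close> is \<open>U\<^sub>i x\<^sup>i = U\<^sub>i U\<^sub>i\<^sup>T x\<close>.
\<close>

definition block_space :: "('m \<Rightarrow> 'n) \<Rightarrow> 'n \<Rightarrow> (real ^ 'm) set" where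
  "block_space b i = {x. \<forall>j. b j \<noteq> i \<longrightarrow> x $ j = 0}"

definition block :: "('m \<Rightarrow> 'n) \<Rightarrow> 'n \<Rightarrow> real ^ 'm \<Rightarrow> real ^ 'm" where
  "block b i x = (\<chi> j. if b j = i then x $ j else 0)"

definition restrict_blocks :: "('m \<Rightarrow> 'n) \<Rightarrow> 'n set \<Rightarrow> real ^ 'm \<Rightarrow> real ^ 'm" where
  "restrict_blocks b S h = (\<Sum>i\<in>S. block b i h)"

definition scale_blocks :: "('m \<Rightarrow> 'n::finite) \<Rightarrow> real ^ 'n \<Rightarrow> real ^ 'm \<Rightarrow> real ^ 'm" where
  "scale_blocks b u x = (\<Sum>i\<in>UNIV. (u $ i) *\<^sub>R block b i x)"

text \<open>
  Only the entries of \<open>A\<close> with both indices in block \<open>i\<close> matter: they form the symmetric positive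
  definite matrix attached to the block, and \<open>block_norm2\<close> evaluates its quadratic form at \<open>x\<^sup>i\<close>.
\<close>

definition sym_pos_def_on_block :: "('m \<Rightarrow> 'n) \<Rightarrow> 'n \<Rightarrow> real ^ 'm ^ 'm \<Rightarrow> bool" where
  "sym_pos_def_on_block b i A \<longleftrightarrow>
     (\<forall>j k. b j = i \<longrightarrow> b k = i \<longrightarrow> A $ j $ k = A $ k $ j) \<and>
     (\<forall>x\<in>block_space b i. x \<noteq> 0 \<longrightarrow> 0 < (A *v x) \<bullet> x)"

definition block_norm2 :: "('m \<Rightarrow> 'n) \<Rightarrow> ('n \<Rightarrow> real ^ 'm ^ 'm) \<Rightarrow> 'n \<Rightarrow> real ^ 'm \<Rightarrow> real" where
  "block_norm2 b B i x = (B i *v block b i x) \<bullet> block b i x"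

definition weighted_inner ::
  "('m \<Rightarrow> 'n::finite) \<Rightarrow> real ^ 'n \<Rightarrow> real ^ 'm \<Rightarrow> real ^ 'm \<Rightarrow> real" where
  "weighted_inner b w x y = (\<Sum>i\<in>UNIV. w $ i * (block b i x \<bullet> block b i y))"

definition weighted_norm2 ::
  "('m \<Rightarrow> 'n::finite) \<Rightarrow> ('n \<Rightarrow> real ^ 'm ^ 'm) \<Rightarrow> real ^ 'n \<Rightarrow> real ^ 'm \<Rightarrow> real" where
  "weighted_norm2 b B w x = (\<Sum>i\<in>UNIV. w $ i * block_norm2 b B i x)"

definition grad :: "(real ^ 'm \<Rightarrow> real) \<Rightarrow> real ^ 'm \<Rightarrow> real ^ 'm" where
  "grad f x = (THE D. GDERIV f x :> D)"

definition ext_convex_on :: "'a::real_vector set \<Rightarrow> ('a \<Rightarrow> ereal) \<Rightarrow> bool" where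
  "ext_convex_on C g \<longleftrightarrow> convex C \<and>
     (\<forall>x\<in>C. \<forall>y\<in>C. \<forall>t\<in>{0..1}.
        g ((1 - t) *\<^sub>R x + t *\<^sub>R y) \<le> ereal (1 - t) * g x + ereal t * g y)"

definition ext_closed_on :: "'a::topological_space set \<Rightarrow> ('a \<Rightarrow> ereal) \<Rightarrow> bool" where
  "ext_closed_on C g \<longleftrightarrow> closed {(x, t :: real). x \<in> C \<and> g x \<le> ereal t}"

definition separable_sum ::
  "('m \<Rightarrow> 'n::finite) \<Rightarrow> ('n \<Rightarrow> real ^ 'm \<Rightarrow> ereal) \<Rightarrow> real ^ 'm \<Rightarrow> ereal" where
  "separable_sum b \<psi> x = (\<Sum>i\<in>UNIV. \<psi> i (block b i x))"

definition ext_dom :: "('a \<Rightarrow> ereal) \<Rightarrow> 'a set" where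
  "ext_dom g = {x. g x < \<infinity>}"

definition sampling_prob :: "('n::finite) set pmf \<Rightarrow> real ^ 'n" where
  "sampling_prob Shat = (\<chi> i. measure_pmf.prob Shat {S. i \<in> S})"

definition proper_sampling :: "('n::finite) set pmf \<Rightarrow> bool" where
  "proper_sampling Shat \<longleftrightarrow> (\<forall>i. sampling_prob Shat $ i > 0)"

definition ESO ::
  "('m \<Rightarrow> 'n::finite) \<Rightarrow> ('n \<Rightarrow> real ^ 'm ^ 'm) \<Rightarrow> (real ^ 'm \<Rightarrow> real) \<Rightarrow> 'n set pmf \<Rightarrow> real ^ 'n \<Rightarrow> bool"
  where
  "ESO b B f Shat v \<longleftrightarrow>
     (\<forall>x h. measure_pmf.expectation Shat (\<lambda>S. f (x + restrict_blocks b S h))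
        \<le> f x + weighted_inner b (sampling_prob Shat) (grad f x) h
          + 1 / 2 * weighted_norm2 b B (\<chi> i. v $ i * sampling_prob Shat $ i) h)"

text \<open>
  One run of ALPHA started at \<open>x0\<close>, where \<open>S k\<close> is the set of blocks drawn at step \<open>k\<close>.
\<close>

definition alpha_run ::
  "('m \<Rightarrow> 'n::finite) \<Rightarrow> ('n \<Rightarrow> real ^ 'm ^ 'm) \<Rightarrow> (real ^ 'm \<Rightarrow> real) \<Rightarrow> ('n \<Rightarrow> real ^ 'm \<Rightarrow> ereal) \<Rightarrow>
   real ^ 'n \<Rightarrow> real ^ 'n \<Rightarrow> (nat \<Rightarrow> real) \<Rightarrow> real ^ 'm \<Rightarrow> (nat \<Rightarrow> 'n set) \<Rightarrow>
   (nat \<Rightarrow> real ^ 'm) \<Rightarrow> (nat \<Rightarrow> real ^ 'm) \<Rightarrow> (nat \<Rightarrow> real ^ 'm) \<Rightarrow> bool"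
  where
  "alpha_run b B f \<psi> p v \<theta> x0 S x y z \<longleftrightarrow>
     x 0 = x0 \<and> z 0 = x0 \<and>
     (\<forall>k. y k = (1 - \<theta> k) *\<^sub>R x k + \<theta> k *\<^sub>R z k \<and>
        (\<forall>i\<in>S k. is_arg_min
           (\<lambda>u. ereal (block b i (grad f (y k)) \<bullet> u
                  + \<theta> k * v $ i / (2 * p $ i) * block_norm2 b B i (u - block b i (z k))) + \<psi> i u)
           (\<lambda>u. u \<in> block_space b i)
           (block b i (z (Suc k)))) \<and>
        (\<forall>i. i \<notin> S k \<longrightarrow> block b i (z (Suc k)) = block b i (z k)) \<and>
        x (Suc k) = y k + \<theta> k *\<^sub>R scale_blocks b (\<chi> i. inverse (p $ i)) (z (Suc k) - z k))"

text \<open>\<open>alpha_coeff \<theta> q k l\<close> is \<open>\<gamma>\<^sup>i\<close> at index \<open>(k, l)\<close> when \<open>q = p\<^sub>i\<close>, and 0 for \<open>l > k\<close>.\<close>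

fun alpha_coeff :: "(nat \<Rightarrow> real) \<Rightarrow> real \<Rightarrow> nat \<Rightarrow> nat \<Rightarrow> real" where
  "alpha_coeff \<theta> q 0 l = (if l = 0 then 1 else 0)"
| "alpha_coeff \<theta> q (Suc 0) l =
     (if l = 0 then 1 - \<theta> 0 / q else if l = 1 then \<theta> 0 / q else 0)"
| "alpha_coeff \<theta> q (Suc (Suc j)) l =
     (let k = Suc j in
      if l < k then (1 - \<theta> k) * alpha_coeff \<theta> q k l
      else if l = k then (1 - \<theta> k) * alpha_coeff \<theta> q k k + \<theta> k - \<theta> k / q
      else if l = Suc k then \<theta> k / q
      else 0)"

definition psi_hat ::
  "('m \<Rightarrow> 'n::finite) \<Rightarrow> ('n \<Rightarrow> real ^ 'm \<Rightarrow> ereal) \<Rightarrow> real ^ 'n \<Rightarrow> (nat \<Rightarrow> real) \<Rightarrow>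
   (nat \<Rightarrow> real ^ 'm) \<Rightarrow> nat \<Rightarrow> ereal" where
  "psi_hat b \<psi> p \<theta> z k =
     (\<Sum>i\<in>UNIV. \<Sum>l\<le>k. ereal (alpha_coeff \<theta> (p $ i) k l) * \<psi> i (block b i (z l)))"

definition F_hat ::
  "('m \<Rightarrow> 'n::finite) \<Rightarrow> (real ^ 'm \<Rightarrow> real) \<Rightarrow> ('n \<Rightarrow> real ^ 'm \<Rightarrow> ereal) \<Rightarrow> real ^ 'n \<Rightarrow>
   (nat \<Rightarrow> real) \<Rightarrow> (nat \<Rightarrow> real ^ 'm) \<Rightarrow> (nat \<Rightarrow> real ^ 'm) \<Rightarrow> nat \<Rightarrow> ereal" where
  "F_hat b f \<psi> p \<theta> x z k = psi_hat b \<psi> p \<theta> z k + ereal (f (x k))"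

text \<open>The sigma-algebra generated by the first \<open>k\<close> draws \<open>S 0, \<dots>, S (k - 1)\<close>.\<close>

definition draw_history :: "'w measure \<Rightarrow> (nat \<Rightarrow> 'w \<Rightarrow> 'n set) \<Rightarrow> nat \<Rightarrow> 'w measure" where
  "draw_history M S k = sigma (space M) {S j -` A \<inter> space M | j A. j < k}"

end

theory Submission
  imports Defs
begin

text \<open>
  Fix the past and write \<open>t = \<theta> k\<close>, \<open>(x, z)\<close> for the current iterates, \<open>w = (1 - t) x + t z\<close> for the
  extrapolated point, and \<open>u\<close> for the point all of whose blocks solve their proximal subproblems at
  \<open>w\<close>. A draw \<open>T\<close> replaces exactly the blocks of \<open>z\<close> in \<open>T\<close> by those of \<open>u\<close>, so the only randomness
  left is \<open>T\<close>, and block \<open>i\<close> is replaced with probability \<open>p i\<close>. The weights of the algorithm are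
  chosen so that averaging over \<open>T\<close> removes one factor \<open>1 / p i\<close> everywhere: \<open>psi_hat\<close> becomes
  \<open>(1 - t) psi_hat + t \<psi>(u)\<close>, the weighted distance interpolates between those of \<open>z\<close> and \<open>u\<close>, and the
  ESO inequality bounds \<open>f\<close> by its linearisation at \<open>w\<close> plus a quadratic in \<open>u - z\<close>. What has to be
  estimated is then, block by block, \<open>t\<close> times the proximal objective at its minimiser. Strong
  convexity (\<open>strongly_convex_minimizer_gap\<close>) compares it with the value at \<open>y\<close> and leaves a gap that
  cancels the distance from \<open>u\<close> to \<open>y\<close>; two tangent inequalities for \<open>f\<close> at \<open>w\<close> finish the estimate.
  This is \<open>expectation_step_value\<close>.

  To pass from a fixed past to the conditional expectation, note that strong convexity also makes the
  minimisers unique, so that the iterates up to step \<open>k\<close> are functions of the first \<open>k\<close> draws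
  (\<open>alpha_run_determined\<close>). There are finitely many such histories, so these functions are measurable
  and bounded, and the independence of the next draw turns the conditional expectation into an
  expectation over the sampling (\<open>cond_exp_fresh_draw\<close>).

  The point \<open>u\<close> is obtained from the run itself: almost every history can be continued by a draw that
  contains a given block (\<open>AE_some_outcome_draws\<close>), and that continuation exhibits a minimiser in the
  block.
\<close>

section \<open>Block decomposition\<close>

lemma block_nth: "block b i x $ j = (if b j = i then x $ j else 0)"
  by (simp add: block_def)

lemma block_in_space: "block b i x \<in> block_space b i"
  by (simp add: block_space_def block_nth)

lemma block_of_space: "u \<in> block_space b i \<Longrightarrow> block b i u = u"
  by (auto simp: block_space_def vec_eq_iff block_nth)

lemma block_block: "block b i (block b j x) = (if i = j then block b i x else 0)"
  by (auto simp: vec_eq_iff block_nth)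

lemma linear_block: "linear (block b i)"
  by (auto simp: linear_iff vec_eq_iff block_nth)

lemmas block_add = linear_add[OF linear_block]
lemmas block_diff = linear_diff[OF linear_block]
lemmas block_scaleR = linear_scale[OF linear_block]
lemmas block_sum = linear_sum[OF linear_block]

lemma sum_blocks:
  fixes b :: "'m::finite \<Rightarrow> 'n::finite"
  shows "(\<Sum>i\<in>UNIV. block b i x) = x"
  unfolding vec_eq_iff by (simp add: block_nth)

lemma vec_eq_blockI:
  fixes b :: "'m::finite \<Rightarrow> 'n::finite"
  assumes "\<And>i. block b i x = block b i y"
  shows "x = y"
proof -
  have "(\<Sum>i\<in>UNIV. block b i x) = (\<Sum>i\<in>UNIV. block b i y)"
    using assms by (simp only:)
  then show ?thesis
    by (simp only: sum_blocks)
qed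

lemma block_sum_blocks:
  fixes b :: "'m::finite \<Rightarrow> 'n::finite"
  assumes "\<And>i. u i \<in> block_space b i"
  shows "block b j (\<Sum>i\<in>UNIV. u i) = u j"
proof -
  have "block b j (\<Sum>i\<in>UNIV. u i) = (\<Sum>i\<in>UNIV. block b j (block b i (u i)))"
    using assms by (simp add: block_sum block_of_space)
  also have "\<dots> = block b j (u j)"
    by (simp add: block_block)
  finally show ?thesis
    using assms by (simp add: block_of_space)
qed

lemma block_restrict_blocks:
  fixes b :: "'m::finite \<Rightarrow> 'n::finite"
  shows "block b i (restrict_blocks b T h) = (if i \<in> T then block b i h else 0)"
  by (simp add: restrict_blocks_def block_sum block_block)

lemma block_scale_blocks:
  fixes b :: "'m::finite \<Rightarrow> 'n::finite"
  shows "block b i (scale_blocks b u h) = (u $ i) *\<^sub>R block b i h"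
  by (simp add: scale_blocks_def block_sum block_scaleR block_block if_distrib cong: if_cong)

lemma inner_block_self:
  fixes x y :: "real ^ 'm::finite"
  shows "block b i x \<bullet> block b i y = block b i x \<bullet> y"
  by (auto simp: inner_vec_def block_nth intro!: sum.cong)

lemma block_norm2_block: "block_norm2 b B i (block b i x) = block_norm2 b B i x"
  by (simp add: block_norm2_def block_block)

lemma block_norm2_scaleR:
  fixes b :: "'m::finite \<Rightarrow> 'n::finite"
  shows "block_norm2 b B i (c *\<^sub>R x) = c\<^sup>2 * block_norm2 b B i x"
  by (simp add: block_norm2_def block_scaleR matrix_vector_mult_scaleR power2_eq_square)

lemma block_norm2_cong: "block b i x = block b i y \<Longrightarrow> block_norm2 b B i x = block_norm2 b B i y"
  by (simp add: block_norm2_def)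

lemma block_norm2_minus:
  fixes b :: "'m::finite \<Rightarrow> 'n::finite"
  shows "block_norm2 b B i (x - y) = block_norm2 b B i (y - x)"
  using block_norm2_scaleR[of b B i "-1" "x - y"] by simp

lemma block_norm2_eq_0_imp:
  assumes "sym_pos_def_on_block b i (B i)" "block_norm2 b B i x \<le> 0"
  shows "block b i x = 0"
  using assms block_in_space[of b i x] unfolding sym_pos_def_on_block_def block_norm2_def
  by force

text \<open>
  This identity holds for the diagonal of any bilinear form; it is what makes the proximal
  objective of a block strongly convex.
\<close>

lemma block_norm2_convex_combination:
  fixes b :: "'m::finite \<Rightarrow> 'n::finite"
  shows "block_norm2 b B i ((1 - t) *\<^sub>R x + t *\<^sub>R y) =
    (1 - t) * block_norm2 b B i x + t * block_norm2 b B i y - t * (1 - t) * block_norm2 b B i (y - x)"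
proof -
  define L where "L h = B i *v block b i h" for h
  have lin: "linear L"
    unfolding L_def by (simp add: linear_iff block_add block_scaleR matrix_vector_right_distrib
        matrix_vector_mult_scaleR)
  have "L ((1 - t) *\<^sub>R x + t *\<^sub>R y) = (1 - t) *\<^sub>R L x + t *\<^sub>R L y" "L (y - x) = L y - L x"
    by (simp_all only: linear_add[OF lin] linear_scale[OF lin] linear_diff[OF lin])
  then show ?thesis
    unfolding block_norm2_def L_def[symmetric]
    by (simp only: block_add block_scaleR block_diff inner_add_left inner_add_right inner_diff_left
        inner_diff_right inner_scaleR_left inner_scaleR_right) (simp add: algebra_simps)
qed

section \<open>Convex functions\<close>

lemma GDERIV_grad:
  assumes "f differentiable (at x)"
  shows "GDERIV f x :> grad f x"
proof -
  obtain L where L: "(f has_derivative L) (at x)"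
    using assms by (auto simp: differentiable_def)
  have lin: "linear L"
    using L by (rule has_derivative_linear)
  have "L = (\<lambda>h. h \<bullet> (\<Sum>i\<in>Basis. L i *\<^sub>R i))"
  proof
    fix h
    have "L h = L (\<Sum>i\<in>Basis. (h \<bullet> i) *\<^sub>R i)"
      by (simp only: euclidean_representation)
    then show "L h = h \<bullet> (\<Sum>i\<in>Basis. L i *\<^sub>R i)"
      by (simp add: linear_sum[OF lin] linear_scale[OF lin] inner_sum_right mult.commute)
  qed
  then have *: "GDERIV f x :> (\<Sum>i\<in>Basis. L i *\<^sub>R i)"
    using L by (simp add: gderiv_def)
  have unique: "D = D'" if "GDERIV f x :> D" "GDERIV f x :> D'" for D D'
  proof -
    have "(\<lambda>h. h \<bullet> D) = (\<lambda>h. h \<bullet> D')"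
      using that unfolding gderiv_def by (rule has_derivative_unique)
    then have "\<forall>h. h \<bullet> D = h \<bullet> D'"
      by (blast dest: fun_cong)
    then show ?thesis
      by (simp only: vector_eq_ldot)
  qed
  show ?thesis
    unfolding grad_def by (rule theI) (use * unique in blast)+
qed

lemma convex_above_gradient:
  fixes f :: "real ^ 'm \<Rightarrow> real"
  assumes convex: "convex_on UNIV f" and diff: "f differentiable (at x)"
  shows "f x + grad f x \<bullet> (y - x) \<le> f y"
proof -
  let ?g = "\<lambda>t::real. f (x + t *\<^sub>R (y - x))"
  have "convex_on UNIV ?g"
  proof (rule convex_onI)
    fix t r s :: real assume t: "0 < t" "t < 1"
    have "x + ((1 - t) *\<^sub>R r + t *\<^sub>R s) *\<^sub>R (y - x)
        = (1 - t) *\<^sub>R (x + r *\<^sub>R (y - x)) + t *\<^sub>R (x + s *\<^sub>R (y - x))"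
      by (simp add: algebra_simps)
    then show "?g ((1 - t) *\<^sub>R r + t *\<^sub>R s) \<le> (1 - t) * ?g r + t * ?g s"
      using convex_onD[OF convex, of t "x + r *\<^sub>R (y - x)" "x + s *\<^sub>R (y - x)"] t by simp
  qed auto
  moreover have "(?g has_field_derivative (grad f x \<bullet> (y - x))) (at 0 within UNIV)"
  proof -
    have "(f has_derivative (\<lambda>h. h \<bullet> grad f x)) (at (x + 0 *\<^sub>R (y - x)))"
      using GDERIV_grad[OF diff] by (simp add: gderiv_def)
    then have "(?g has_derivative (\<lambda>t. (t *\<^sub>R (y - x)) \<bullet> grad f x)) (at 0)"
      by (rule has_derivative_compose[rotated]) (auto intro!: derivative_eq_intros)
    then show ?thesis
      unfolding has_field_derivative_def
      by (rule has_derivative_eq_rhs) (auto simp: fun_eq_iff inner_commute)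
  qed
  ultimately have "(grad f x \<bullet> (y - x)) * (1 - 0) \<le> ?g 1 - ?g 0"
    by (intro convex_on_imp_above_tangent[of UNIV]) auto
  then show ?thesis by simp
qed

text \<open>
  Along the segment from the minimiser \<open>z\<close> to \<open>y\<close> the objective cannot drop below its value at
  \<open>z\<close>, while strong convexity puts it below the chord by \<open>t (1 - t) d\<close>. Dividing by \<open>t\<close> and
  letting \<open>t\<close> tend to 0 leaves the full gap \<open>d\<close>.
\<close>

lemma strongly_convex_minimizer_gap:
  fixes \<phi> :: "'a::real_vector \<Rightarrow> real" and \<psi> :: "'a \<Rightarrow> ereal"
  assumes min: "is_arg_min (\<lambda>u. ereal (\<phi> u) + \<psi> u) (\<lambda>u. u \<in> C) z"
    and convex: "ext_convex_on C \<psi>"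
    and fin: "\<bar>\<psi> z\<bar> \<noteq> \<infinity>" and y: "y \<in> C" "\<psi> y \<noteq> -\<infinity>"
    and strong: "\<And>t. 0 < t \<Longrightarrow> t < 1 \<Longrightarrow>
      \<phi> ((1 - t) *\<^sub>R z + t *\<^sub>R y) \<le> (1 - t) * \<phi> z + t * \<phi> y - t * (1 - t) * d"
  shows "ereal (\<phi> z + d) + \<psi> z \<le> ereal (\<phi> y) + \<psi> y"
proof (cases "\<psi> y")
  case (real r)
  obtain a where a: "\<psi> z = ereal a"
    using fin by auto
  have z: "z \<in> C" and le: "\<And>u. u \<in> C \<Longrightarrow> ereal (\<phi> z) + \<psi> z \<le> ereal (\<phi> u) + \<psi> u"
    using min by (auto simp: is_arg_min_linorder)
  have *: "\<phi> z + a + (1 - t) * d \<le> \<phi> y + r" if t: "0 < t" "t < 1" for t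
  proof -
    let ?u = "(1 - t) *\<^sub>R z + t *\<^sub>R y"
    have "?u \<in> C"
      using convex z y t unfolding ext_convex_on_def by (auto intro: convexD_alt)
    moreover have "\<psi> ?u \<le> ereal ((1 - t) * a + t * r)"
      using convex z y t a real unfolding ext_convex_on_def by fastforce
    ultimately have "ereal (\<phi> z + a) \<le> ereal (\<phi> ?u + ((1 - t) * a + t * r))"
      using le[of ?u] a by (cases "\<psi> ?u") auto
    with strong[OF t] have "t * (\<phi> z + a + (1 - t) * d) \<le> t * (\<phi> y + r)"
      by (simp add: algebra_simps)
    with t show ?thesis by simp
  qed
  have "((\<lambda>t. \<phi> z + a + (1 - t) * d) \<longlongrightarrow> \<phi> z + a + (1 - 0) * d) (at_right 0)"
    by (intro tendsto_intros)
  moreover have "eventually (\<lambda>t. \<phi> z + a + (1 - t) * d \<le> \<phi> y + r) (at_right 0)"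
    using eventually_at_right_less[of 0] eventually_at_right_real[of 0 1]
    by (auto elim!: eventually_mono intro!: *)
  ultimately have "\<phi> z + a + (1 - 0) * d \<le> \<phi> y + r"
    by (intro tendsto_upperbound) auto
  then show ?thesis
    using a real by (simp add: algebra_simps)
qed (use y in auto)

lemma arg_min_finite:
  assumes "is_arg_min (\<lambda>u. ereal (\<phi> u) + \<psi> u) (\<lambda>u. u \<in> C) z" "w \<in> C" "\<psi> w < \<infinity>" "\<psi> z \<noteq> -\<infinity>"
  shows "\<bar>\<psi> z\<bar> \<noteq> \<infinity>"
proof -
  have "ereal (\<phi> z) + \<psi> z \<le> ereal (\<phi> w) + \<psi> w"
    using assms by (auto simp: is_arg_min_linorder)
  also have "\<dots> < \<infinity>"
    using assms by simp
  finally show ?thesis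
    using assms by auto
qed

section \<open>The inequality for one step, given the past\<close>

text \<open>
  The value of \<open>F_hat + t\<^sup>2/2 \<parallel>z - y\<parallel>\<^sup>2\<close> after a step from \<open>(x, z)\<close> in which the set \<open>T\<close> is
  drawn, when every block of \<open>u\<close> solves its proximal subproblem. In block \<open>i\<close>, \<open>a i\<close> stands for
  the value of \<open>psi_hat\<close> before the step, \<open>r i\<close> for \<open>\<psi>\<close> at \<open>z\<close> and \<open>s i\<close> for \<open>\<psi>\<close> at \<open>u\<close>. Neither
  these data nor \<open>x\<close>, \<open>z\<close>, \<open>u\<close> depend on \<open>T\<close>, so the conditional expectation given the past becomes
  an ordinary expectation over \<open>T\<close>.
\<close>

definition step_value ::
  "('m::finite \<Rightarrow> 'n::finite) \<Rightarrow> ('n \<Rightarrow> real ^ 'm ^ 'm) \<Rightarrow> (real ^ 'm \<Rightarrow> real) \<Rightarrow> real ^ 'n \<Rightarrow> real ^ 'n \<Rightarrow>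
   real \<Rightarrow> real ^ 'm \<Rightarrow> ('n \<Rightarrow> real) \<Rightarrow> ('n \<Rightarrow> real) \<Rightarrow> ('n \<Rightarrow> real) \<Rightarrow>
   real ^ 'm \<Rightarrow> real ^ 'm \<Rightarrow> real ^ 'm \<Rightarrow> 'n set \<Rightarrow> real"
  where
  "step_value b B f p v t y a r s x z u T =
     (\<Sum>i\<in>UNIV. (1 - t) * a i + t * r i + t / p $ i * ((if i \<in> T then s i else r i) - r i))
     + f ((1 - t) *\<^sub>R x + t *\<^sub>R z
          + restrict_blocks b T (t *\<^sub>R scale_blocks b (\<chi> i. inverse (p $ i)) (u - z)))
     + t\<^sup>2 / 2 * weighted_norm2 b B (\<chi> i. v $ i / (p $ i)\<^sup>2) (z + restrict_blocks b T (u - z) - y)"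

lemma expectation_draw_block:
  fixes Shat :: "'n::finite set pmf"
  shows "measure_pmf.expectation Shat (\<lambda>T. if i \<in> T then c else d)
    = sampling_prob Shat $ i * c + (1 - sampling_prob Shat $ i) * (d :: real)"
proof -
  have "(\<lambda>T. if i \<in> T then c else d) = (\<lambda>T. d + (c - d) * indicator {T. i \<in> T} T)"
    by (auto simp: fun_eq_iff)
  then show ?thesis
    by (simp add: sampling_prob_def integrable_measure_pmf_finite algebra_simps)
qed

definition prox_smooth ::
  "('m::finite \<Rightarrow> 'n::finite) \<Rightarrow> ('n \<Rightarrow> real ^ 'm ^ 'm) \<Rightarrow> (real ^ 'm \<Rightarrow> real) \<Rightarrow> real ^ 'n \<Rightarrow> real ^ 'n \<Rightarrow>
   real \<Rightarrow> real ^ 'm \<Rightarrow> real ^ 'm \<Rightarrow> 'n \<Rightarrow> real ^ 'm \<Rightarrow> real"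
  where
  "prox_smooth b B f p v t x z i u =
     block b i (grad f ((1 - t) *\<^sub>R x + t *\<^sub>R z)) \<bullet> u
     + t * v $ i / (2 * p $ i) * block_norm2 b B i (u - block b i z)"

definition prox_min ::
  "('m::finite \<Rightarrow> 'n::finite) \<Rightarrow> ('n \<Rightarrow> real ^ 'm ^ 'm) \<Rightarrow> (real ^ 'm \<Rightarrow> real) \<Rightarrow> ('n \<Rightarrow> real ^ 'm \<Rightarrow> ereal) \<Rightarrow>
   real ^ 'n \<Rightarrow> real ^ 'n \<Rightarrow> real \<Rightarrow> real ^ 'm \<Rightarrow> real ^ 'm \<Rightarrow> 'n \<Rightarrow> real ^ 'm \<Rightarrow> bool"
  where
  "prox_min b B f \<psi> p v t x z i u \<longleftrightarrow>
     is_arg_min (\<lambda>u. ereal (prox_smooth b B f p v t x z i u) + \<psi> i u) (\<lambda>u. u \<in> block_space b i) u"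

lemma prox_min_gap:
  fixes b :: "'m::finite \<Rightarrow> 'n::finite"
  assumes min: "prox_min b B f \<psi> p v t x z i u"
    and convex: "ext_convex_on (block_space b i) (\<psi> i)"
    and fin: "\<bar>\<psi> i u\<bar> \<noteq> \<infinity>" and w: "w \<in> block_space b i" "\<psi> i w \<noteq> -\<infinity>"
  shows "ereal (prox_smooth b B f p v t x z i u + t * v $ i / (2 * p $ i) * block_norm2 b B i (w - u)) + \<psi> i u
    \<le> ereal (prox_smooth b B f p v t x z i w) + \<psi> i w"
proof (rule strongly_convex_minimizer_gap[OF min[unfolded prox_min_def] convex fin w])
  fix \<tau> :: real
  have "(1 - \<tau>) *\<^sub>R u + \<tau> *\<^sub>R w - block b i z
      = (1 - \<tau>) *\<^sub>R (u - block b i z) + \<tau> *\<^sub>R (w - block b i z)"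
    by (simp add: algebra_simps)
  then have "block_norm2 b B i ((1 - \<tau>) *\<^sub>R u + \<tau> *\<^sub>R w - block b i z)
      = (1 - \<tau>) * block_norm2 b B i (u - block b i z) + \<tau> * block_norm2 b B i (w - block b i z)
        - \<tau> * (1 - \<tau>) * block_norm2 b B i (w - u)"
    by (simp only: block_norm2_convex_combination) simp
  then show "prox_smooth b B f p v t x z i ((1 - \<tau>) *\<^sub>R u + \<tau> *\<^sub>R w)
      \<le> (1 - \<tau>) * prox_smooth b B f p v t x z i u + \<tau> * prox_smooth b B f p v t x z i w
        - \<tau> * (1 - \<tau>) * (t * v $ i / (2 * p $ i) * block_norm2 b B i (w - u))"
    unfolding prox_smooth_def
    by (simp only: inner_add_right inner_scaleR_right) (simp add: algebra_simps diff_divide_distrib add_divide_distrib)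
qed

lemma prox_min_unique:
  fixes b :: "'m::finite \<Rightarrow> 'n::finite"
  assumes min: "prox_min b B f \<psi> p v t x z i u" "prox_min b B f \<psi> p v t x z i w"
    and convex: "ext_convex_on (block_space b i) (\<psi> i)"
    and fin: "\<bar>\<psi> i u\<bar> \<noteq> \<infinity>" "\<bar>\<psi> i w\<bar> \<noteq> \<infinity>"
    and pos: "0 < t" "v $ i > 0" "p $ i > 0" and B: "sym_pos_def_on_block b i (B i)"
  shows "u = w"
proof -
  have sp: "u \<in> block_space b i" "w \<in> block_space b i"
    using min by (auto simp: prox_min_def is_arg_min_linorder)
  obtain c d where cd: "\<psi> i u = ereal c" "\<psi> i w = ereal d"
    using fin by (cases "\<psi> i u"; cases "\<psi> i w") auto
  have "ereal (prox_smooth b B f p v t x z i w) + \<psi> i w \<le> ereal (prox_smooth b B f p v t x z i u) + \<psi> i u"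
    using min sp by (auto simp: prox_min_def is_arg_min_linorder)
  moreover have "ereal (prox_smooth b B f p v t x z i u + t * v $ i / (2 * p $ i) * block_norm2 b B i (w - u))
      + \<psi> i u \<le> ereal (prox_smooth b B f p v t x z i w) + \<psi> i w"
    by (rule prox_min_gap) (use min convex fin sp in auto)
  ultimately have "(t * v $ i / (2 * p $ i)) * block_norm2 b B i (w - u) \<le> 0"
    unfolding cd by (simp only: plus_ereal.simps ereal_less_eq)
  moreover have "t * v $ i / (2 * p $ i) > 0"
    using pos by simp
  ultimately have "block_norm2 b B i (w - u) \<le> 0"
    by (meson not_le mult_pos_pos)
  then have "block b i (w - u) = 0"
    using B by (rule block_norm2_eq_0_imp[rotated])
  with sp show ?thesis
    by (simp add: block_diff block_of_space)
qed

text \<open>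
  For \<open>\<psi> i\<close> and the distance, drawing block \<open>i\<close> with probability \<open>p i\<close> turns the factors \<open>1/p i\<close>
  and \<open>1/(p i)\<^sup>2\<close> into \<open>1\<close> and \<open>1/p i\<close>; for \<open>f\<close> the ESO inequality, applied to the direction
  \<open>t (u - z) / p\<close>, has the same effect. What is left in block \<open>i\<close> is \<open>t\<close> times the proximal
  objective at \<open>u\<close>, and the gap inequality compares it with its value at \<open>y\<close>. The distance terms
  then cancel down to \<open>\<parallel>z - y\<parallel>\<^sup>2\<close>, and the linear terms are bounded by two tangent inequalities at
  \<open>w = (1 - t) x + t z\<close>, since \<open>t (y - z) = t (y - w) + (1 - t) (x - w)\<close>.
\<close>

lemma expectation_step_value:
  fixes b :: "'m::finite \<Rightarrow> 'n::finite" and Shat :: "'n set pmf"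
  defines "p \<equiv> sampling_prob Shat"
  assumes f_convex: "convex_on UNIV f" and f_diff: "\<And>x. f differentiable (at x)"
    and psi_convex: "\<And>i. ext_convex_on (block_space b i) (\<psi> i)"
    and p_pos: "\<And>i. p $ i > 0"
    and eso: "ESO b B f Shat v" and t: "0 < t" "t \<le> 1"
    and u: "\<And>i. prox_min b B f \<psi> p v t x z i (block b i u)"
    and s: "\<And>i. \<psi> i (block b i u) = ereal (s i)"
    and q: "\<And>i. \<psi> i (block b i y) = ereal (q i)"
  shows "measure_pmf.expectation Shat (step_value b B f p v t y a r s x z u)
    \<le> (1 - t) * ((\<Sum>i\<in>UNIV. a i) + f x) + t * (f y + (\<Sum>i\<in>UNIV. q i))
      + t\<^sup>2 / 2 * weighted_norm2 b B (\<chi> i. v $ i / (p $ i)\<^sup>2) (z - y)"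
proof -
  let ?E = "measure_pmf.expectation Shat"
  let ?N = "block_norm2 b B"
  let ?h = "t *\<^sub>R scale_blocks b (\<chi> i. inverse (p $ i)) (u - z)"
  define w where "w = (1 - t) *\<^sub>R x + t *\<^sub>R z"
  define g where "g i = block b i (grad f w)" for i
  have int: "integrable (measure_pmf Shat) h" for h :: "_ \<Rightarrow> real"
    by (intro integrable_measure_pmf_finite) simp
  have E_psi: "?E (\<lambda>T. \<Sum>i\<in>UNIV. (1 - t) * a i + t * r i + t / p $ i * ((if i \<in> T then s i else r i) - r i))
      = (\<Sum>i\<in>UNIV. (1 - t) * a i + t * s i)"
  proof -
    have "?E (\<lambda>T. (1 - t) * a i + t * r i + t / p $ i * ((if i \<in> T then s i else r i) - r i))
        = (1 - t) * a i + t * s i" for i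
      using p_pos[of i]
      by (simp add: int expectation_draw_block flip: p_def) (simp add: field_simps)
    then show ?thesis
      by (subst Bochner_Integration.integral_sum) (simp_all only: int)
  qed
  have E_f: "?E (\<lambda>T. f (w + restrict_blocks b T ?h))
      \<le> f w + (\<Sum>i\<in>UNIV. t * (g i \<bullet> (u - z)) + t\<^sup>2 / 2 * (v $ i / p $ i * ?N i (u - z)))"
  proof -
    have "p $ i * (block b i (grad f w) \<bullet> block b i ?h) = t * (g i \<bullet> (u - z))" for i
      using p_pos[of i]
      by (simp add: g_def block_scaleR block_scale_blocks inner_block_self)
    moreover have "v $ i * p $ i * ?N i ?h = t\<^sup>2 * (v $ i / p $ i * ?N i (u - z))" for i
    proof -
      have "?N i ?h = t\<^sup>2 * (inverse (p $ i))\<^sup>2 * ?N i (u - z)"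
      proof -
        have "?N i ?h = ?N i ((t * inverse (p $ i)) *\<^sub>R (u - z))"
          by (rule block_norm2_cong) (simp add: block_scaleR block_scale_blocks)
        then show ?thesis
          by (simp only: block_norm2_scaleR power_mult_distrib)
      qed
      then show ?thesis
        using p_pos[of i] by (simp add: field_simps power2_eq_square)
    qed
    ultimately show ?thesis
      using eso[unfolded ESO_def, rule_format, of w ?h]
      by (simp add: weighted_inner_def weighted_norm2_def sum.distrib sum_distrib_left flip: p_def)
  qed
  have E_dist: "?E (\<lambda>T. weighted_norm2 b B (\<chi> i. v $ i / (p $ i)\<^sup>2) (z + restrict_blocks b T (u - z) - y))
      = (\<Sum>i\<in>UNIV. v $ i / (p $ i)\<^sup>2 * (p $ i * ?N i (u - y) + (1 - p $ i) * ?N i (z - y)))"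
  proof -
    have "?N i (z + restrict_blocks b T (u - z) - y) = (if i \<in> T then ?N i (u - y) else ?N i (z - y))" for i T
      by (auto intro!: block_norm2_cong simp: block_diff block_add block_restrict_blocks)
    then show ?thesis
      by (simp add: weighted_norm2_def int expectation_draw_block flip: p_def)
  qed
  have gap: "t * (g i \<bullet> u) + t\<^sup>2 / 2 * (v $ i / p $ i * (?N i (u - z) + ?N i (u - y))) + t * s i
      \<le> t * (g i \<bullet> y) + t\<^sup>2 / 2 * (v $ i / p $ i * ?N i (z - y)) + t * q i" for i
  proof -
    have "ereal (prox_smooth b B f p v t x z i (block b i u)
          + t * v $ i / (2 * p $ i) * ?N i (block b i y - block b i u)) + \<psi> i (block b i u)
        \<le> ereal (prox_smooth b B f p v t x z i (block b i y)) + \<psi> i (block b i y)"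
      by (rule prox_min_gap[OF u psi_convex]) (auto simp: s q block_in_space)
    then have "g i \<bullet> u + t * v $ i / (2 * p $ i) * (?N i (u - z) + ?N i (u - y)) + s i
      \<le> g i \<bullet> y + t * v $ i / (2 * p $ i) * ?N i (z - y) + q i"
      unfolding prox_smooth_def w_def[symmetric]
      by (simp add: s q g_def inner_block_self block_norm2_block block_norm2_minus[of _ _ _ y]
          distrib_left flip: block_diff)
    from mult_left_mono[OF this, of t] t show ?thesis
      by (simp add: algebra_simps power2_eq_square)
  qed
  have "?E (step_value b B f p v t y a r s x z u)
      = (\<Sum>i\<in>UNIV. (1 - t) * a i + t * s i) + ?E (\<lambda>T. f (w + restrict_blocks b T ?h))
        + t\<^sup>2 / 2 * (\<Sum>i\<in>UNIV. v $ i / (p $ i)\<^sup>2 * (p $ i * ?N i (u - y) + (1 - p $ i) * ?N i (z - y)))"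
    unfolding step_value_def w_def[symmetric] E_psi[symmetric] E_dist[symmetric]
    by (simp add: int)
  also have "\<dots> \<le> f w + (\<Sum>i\<in>UNIV. (1 - t) * a i
        + (t * (g i \<bullet> u) + t\<^sup>2 / 2 * (v $ i / p $ i * (?N i (u - z) + ?N i (u - y))) + t * s i)
        - t * (g i \<bullet> z) + t\<^sup>2 / 2 * ((v $ i / (p $ i)\<^sup>2 - v $ i / p $ i) * ?N i (z - y)))"
  proof -
    have "v $ i / (p $ i)\<^sup>2 * (p $ i * c + (1 - p $ i) * d)
        = v $ i / p $ i * c + (v $ i / (p $ i)\<^sup>2 - v $ i / p $ i) * d" for i c d
      using p_pos[of i] by (simp add: field_simps power2_eq_square)
    with E_f show ?thesis
      by (simp add: sum.distrib sum_distrib_left sum_subtractf inner_diff_right distrib_left right_diff_distrib)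
  qed
  also have "\<dots> \<le> f w + (\<Sum>i\<in>UNIV. (1 - t) * a i
        + (t * (g i \<bullet> y) + t\<^sup>2 / 2 * (v $ i / p $ i * ?N i (z - y)) + t * q i)
        - t * (g i \<bullet> z) + t\<^sup>2 / 2 * ((v $ i / (p $ i)\<^sup>2 - v $ i / p $ i) * ?N i (z - y)))"
    by (intro add_left_mono sum_mono add_right_mono diff_right_mono) (use gap in auto)
  also have "\<dots> = (1 - t) * (\<Sum>i\<in>UNIV. a i) + t * (\<Sum>i\<in>UNIV. q i)
      + t\<^sup>2 / 2 * weighted_norm2 b B (\<chi> i. v $ i / (p $ i)\<^sup>2) (z - y) + (f w + t * (grad f w \<bullet> (y - z)))"
  proof -
    have "grad f w \<bullet> h = (\<Sum>i\<in>UNIV. g i \<bullet> h)" for h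
      by (simp add: g_def sum_blocks flip: inner_sum_left)
    then show ?thesis
      by (simp add: weighted_norm2_def sum.distrib sum_distrib_left sum_subtractf inner_diff_right
          algebra_simps)
  qed
  also have "f w + t * (grad f w \<bullet> (y - z)) \<le> (1 - t) * f x + t * f y"
  proof -
    have "t * (grad f w \<bullet> (y - z)) = grad f w \<bullet> (t *\<^sub>R (y - w) + (1 - t) *\<^sub>R (x - w))"
      unfolding inner_scaleR_right[symmetric]
      by (rule arg_cong[of _ _ "inner _"]) (simp add: w_def algebra_simps)
    moreover have "t * (f w + grad f w \<bullet> (y - w)) \<le> t * f y"
      using t convex_above_gradient[OF f_convex f_diff, of w y] by simp
    moreover have "(1 - t) * (f w + grad f w \<bullet> (x - w)) \<le> (1 - t) * f x"
      using t convex_above_gradient[OF f_convex f_diff, of w x] by (intro mult_left_mono) auto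
    ultimately show ?thesis
      by (simp add: inner_add_right algebra_simps)
  qed
  finally show ?thesis
    by (simp add: algebra_simps)
qed

section \<open>Conditioning on finitely many draws\<close>

definition depends_on_draws :: "'w measure \<Rightarrow> (nat \<Rightarrow> 'w \<Rightarrow> 'n set) \<Rightarrow> nat \<Rightarrow> ('w \<Rightarrow> 'a) \<Rightarrow> bool" where
  "depends_on_draws M S k h \<longleftrightarrow>
     (\<forall>\<omega>\<in>space M. \<forall>\<omega>'\<in>space M. (\<forall>j<k. S j \<omega> = S j \<omega>') \<longrightarrow> h \<omega> = h \<omega>')"

lemma space_draw_history: "space (draw_history M S k) = space M"
  unfolding draw_history_def by (intro space_measure_of) auto

lemma sets_draw_history:
  "sets (draw_history M S k) = sigma_sets (space M) {S j -` A \<inter> space M | j A. j < k}"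
  unfolding draw_history_def by (intro sets_measure_of) auto

lemma draw_measurable_history:
  assumes "j < k"
  shows "S j \<in> measurable (draw_history M S k) (count_space UNIV)"
  by (rule measurableI) (use assms in \<open>auto simp: space_draw_history sets_draw_history\<close>)

lemma subalgebra_draw_history:
  assumes "\<And>j. S j \<in> measurable M (count_space UNIV)"
  shows "subalgebra M (draw_history M S k)"
  unfolding subalgebra_def space_draw_history sets_draw_history
  using assms by (auto intro!: sets.sigma_sets_subset measurable_sets)

text \<open>
  The first \<open>k\<close> draws take finitely many values, so the past is generated by finitely many atoms.
  Every function of the past is therefore a simple function, which is where the measurability and
  integrability of the iterates come from.
\<close>

lemma finite_histories:
  fixes S :: "nat \<Rightarrow> 'w \<Rightarrow> 'n::finite set"
  shows "finite ((\<lambda>\<omega>. restrict (\<lambda>j. S j \<omega>) {..<k}) ` \<Omega>)"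
proof (rule finite_subset)
  show "(\<lambda>\<omega>. restrict (\<lambda>j. S j \<omega>) {..<k}) ` \<Omega> \<subseteq> PiE {..<k} (\<lambda>_. UNIV)"
    by (rule image_subsetI) simp
  show "finite (PiE {..<k} (\<lambda>_. UNIV :: 'n set set))"
    by (rule finite_PiE) simp_all
qed

lemma depends_on_draws_finite:
  fixes S :: "nat \<Rightarrow> 'w \<Rightarrow> 'n::finite set"
  assumes "depends_on_draws M S k h"
  shows "finite (h ` space M)"
proof -
  let ?H = "\<lambda>\<omega>. restrict (\<lambda>j. S j \<omega>) {..<k}"
  define h' where "h' s = h (SOME \<omega>. \<omega> \<in> space M \<and> ?H \<omega> = s)" for s
  have "finite (?H ` space M)"
    by (rule finite_histories)
  moreover have "h \<omega> = h' (?H \<omega>)" if "\<omega> \<in> space M" for \<omega>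
  proof -
    define \<omega>' where "\<omega>' = (SOME \<omega>'. \<omega>' \<in> space M \<and> ?H \<omega>' = ?H \<omega>)"
    have *: "\<omega>' \<in> space M \<and> ?H \<omega>' = ?H \<omega>"
      unfolding \<omega>'_def by (rule someI_ex) (use that in blast)
    have "S j \<omega> = S j \<omega>'" if "j < k" for j
      using fun_cong[OF conjunct2[OF *], of j] that by simp
    then show ?thesis
      using assms * that unfolding depends_on_draws_def h'_def \<omega>'_def[symmetric] by blast
  qed
  then have "h ` space M = h' ` ?H ` space M"
    unfolding image_image by (intro image_cong) simp_all
  ultimately show ?thesis by simp
qed

lemma depends_on_draws_measurable:
  fixes S :: "nat \<Rightarrow> 'w \<Rightarrow> 'n::finite set"
  assumes h: "depends_on_draws M S k h"
  shows "h \<in> measurable (draw_history M S k) (count_space UNIV)"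
proof (rule measurableI)
  fix A :: "'a set"
  let ?F = "draw_history M S k"
  let ?H = "\<lambda>\<omega>. restrict (\<lambda>j. S j \<omega>) {..<k}"
  let ?R = "?H ` (h -` A \<inter> space M)"
  have "finite ?R"
    by (rule finite_histories)
  moreover have "{\<omega> \<in> space ?F. \<forall>j\<in>{..<k}. S j \<omega> = s j} \<in> sets ?F" for s
  proof (rule sets.sets_Collect_finite_All)
    fix j assume "j \<in> {..<k}"
    then show "{\<omega> \<in> space ?F. S j \<omega> = s j} \<in> sets ?F"
      using measurable_sets[OF draw_measurable_history[of j k S M], of "{s j}"]
      by (simp add: vimage_def Int_def conj_commute)
  qed simp
  ultimately have "(\<Union>s\<in>?R. {\<omega> \<in> space ?F. \<forall>j\<in>{..<k}. S j \<omega> = s j}) \<in> sets ?F"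
    by (rule sets.finite_UN)
  moreover have "h -` A \<inter> space ?F = (\<Union>s\<in>?R. {\<omega> \<in> space ?F. \<forall>j\<in>{..<k}. S j \<omega> = s j})"
  proof (intro equalityI subsetI)
    fix \<omega> assume "\<omega> \<in> (\<Union>s\<in>?R. {\<omega> \<in> space ?F. \<forall>j\<in>{..<k}. S j \<omega> = s j})"
    then obtain \<omega>' where "\<omega>' \<in> space M" "h \<omega>' \<in> A" "\<omega> \<in> space M" "\<forall>j<k. S j \<omega> = S j \<omega>'"
      by (auto simp: space_draw_history)
    moreover from this have "h \<omega> = h \<omega>'"
      using h unfolding depends_on_draws_def by blast
    ultimately show "\<omega> \<in> h -` A \<inter> space ?F"
      by (simp add: space_draw_history)
  qed (force simp: space_draw_history)
  ultimately show "h -` A \<inter> space ?F \<in> sets ?F"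
    by simp
qed simp

lemma borel_measurable_count_space:
  "h \<in> measurable F (count_space UNIV) \<Longrightarrow> h \<in> borel_measurable F"
  by (rule measurable_compose[where f = h and g = "\<lambda>x. x", simplified]) auto

context prob_space
begin

lemma depends_on_draws_integrable:
  fixes S :: "nat \<Rightarrow> 'a \<Rightarrow> 'n::finite set" and h :: "'a \<Rightarrow> real"
  assumes S: "\<And>j. S j \<in> measurable M (count_space UNIV)" and h: "depends_on_draws M S k h"
  shows "integrable M h"
proof -
  obtain C where "\<forall>x\<in>h ` space M. norm x \<le> C"
    using finite_imp_bounded[OF depends_on_draws_finite[OF h]] by (auto simp: bounded_iff)
  moreover have "h \<in> borel_measurable M"
    using depends_on_draws_measurable[OF h]
    by (intro borel_measurable_count_space measurable_from_subalg[OF subalgebra_draw_history[OF S]])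
  ultimately show ?thesis
    by (intro integrable_const_bound[of _ C]) auto
qed

lemma history_indep_draw:
  fixes S :: "nat \<Rightarrow> 'a \<Rightarrow> 'n set"
  assumes indep: "indep_vars (\<lambda>_. count_space UNIV) S UNIV" and A: "A \<in> sets (draw_history M S k)"
  shows "prob (A \<inter> (S k -` T \<inter> space M)) = prob A * prob (S k -` T \<inter> space M)"
proof -
  let ?E = "\<lambda>j. {S j -` A \<inter> space M | A. A \<in> sets (count_space UNIV)}"
  let ?I = "\<lambda>past. if past then {..<k} else {k}"
  have "indep_sets (\<lambda>past. sigma_sets (space M) (\<Union>j\<in>?I past. ?E j)) UNIV"
  proof (rule indep_sets_collect_sigma)
    show "indep_sets ?E (\<Union>past\<in>UNIV. ?I past)"
      using indep unfolding indep_vars_def2 by (auto intro: indep_sets_mono_index)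
    show "Int_stable (?E j)" for j
    proof (rule Int_stableI)
      fix a c assume "a \<in> ?E j" "c \<in> ?E j"
      then obtain A C where "a = S j -` A \<inter> space M" "c = S j -` C \<inter> space M"
        by auto
      then have "a \<inter> c = S j -` (A \<inter> C) \<inter> space M"
        by auto
      then show "a \<inter> c \<in> ?E j"
        unfolding sets_count_space by blast
    qed
    show "disjoint_family_on ?I UNIV"
      by (auto simp: disjoint_family_on_def)
  qed
  moreover have "A \<in> sigma_sets (space M) (\<Union>j\<in>?I True. ?E j)"
  proof -
    have "{S j -` A \<inter> space M | j A. j < k} = (\<Union>j\<in>?I True. ?E j)"
      by auto
    with A show ?thesis
      by (simp only: sets_draw_history)
  qed
  moreover have "S k -` T \<inter> space M \<in> sigma_sets (space M) (\<Union>j\<in>?I False. ?E j)"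
    by (intro sigma_sets.Basic) auto
  ultimately show ?thesis
    using indep_setsD[of "\<lambda>past. sigma_sets (space M) (\<Union>j\<in>?I past. ?E j)" UNIV UNIV
        "\<lambda>past. if past then A else S k -` T \<inter> space M"]
    by (simp add: UNIV_bool Int_commute mult.commute)
qed

lemma prob_draw:
  assumes X: "X \<in> measurable M (count_space UNIV)"
    and distr: "distr M (count_space UNIV) X = measure_pmf Shat"
  shows "prob (X -` T \<inter> space M) = measure_pmf.prob Shat T"
  using measure_distr[OF X, of T] by (simp add: distr)

text \<open>
  Expand \<open>g (S k \<omega>) \<omega>\<close> as the sum over \<open>T\<close> of \<open>g T \<omega>\<close> times the indicator of \<open>S k \<omega> = T\<close>: the
  first factor is determined by the past and comes out of the conditional expectation, and the
  conditional expectation of the second is the probability of \<open>T\<close>.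
\<close>

lemma cond_exp_fresh_draw:
  fixes S :: "nat \<Rightarrow> 'a \<Rightarrow> 'n::finite set" and g :: "'n set \<Rightarrow> 'a \<Rightarrow> real"
  assumes indep: "indep_vars (\<lambda>_. count_space UNIV) S UNIV"
    and distr: "\<And>j. distr M (count_space UNIV) (S j) = measure_pmf Shat"
    and g: "\<And>T. depends_on_draws M S k (g T)"
    and h: "h \<in> borel_measurable M" "AE \<omega> in M. h \<omega> = g (S k \<omega>) \<omega>"
  shows "AE \<omega> in M. real_cond_exp M (draw_history M S k) h \<omega>
    = measure_pmf.expectation Shat (\<lambda>T. g T \<omega>)"
proof -
  let ?F = "draw_history M S k"
  let ?I = "\<lambda>T \<omega>. indicator (S k -` {T} \<inter> space M) \<omega> :: real"
  have S: "S j \<in> measurable M (count_space UNIV)" for j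
    using indep by (simp add: indep_vars_def2)
  interpret finite_measure_subalgebra M ?F
    by standard (rule subalgebra_draw_history[OF S])
  have mF: "g T \<in> borel_measurable ?F" for T
    by (intro borel_measurable_count_space depends_on_draws_measurable g)
  have ev: "S k -` T \<inter> space M \<in> events" for T
    using measurable_sets[OF S] by simp
  have intI: "integrable M (?I T)" for T
    using ev by (simp add: integrable_indicator_iff emeasure_eq_measure)
  have int: "integrable M (\<lambda>\<omega>. g T \<omega> * ?I T \<omega>)" for T
    using integrable_mult_indicator[OF ev depends_on_draws_integrable[OF S g], of "{T}" T]
    by (simp add: mult.commute)
  have decomp: "g (S k \<omega>) \<omega> = (\<Sum>T\<in>UNIV. g T \<omega> * ?I T \<omega>)" if "\<omega> \<in> space M" for \<omega>
    using that by (simp add: indicator_def if_distrib cong: if_cong)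
  have fresh: "AE \<omega> in M. real_cond_exp M ?F (?I T) \<omega> = pmf Shat T" for T
  proof (rule real_cond_exp_charact)
    fix A assume A: "A \<in> sets ?F"
    then have "A \<in> events"
      using subalgebra_draw_history[of S M k, OF S] by (auto simp: subalgebra_def)
    then have "(\<integral>\<omega>\<in>A. ?I T \<omega> \<partial>M) = prob (A \<inter> (S k -` {T} \<inter> space M))"
      using ev by (simp add: set_lebesgue_integral_def flip: indicator_inter_arith)
    also have "\<dots> = prob A * pmf Shat T"
      using history_indep_draw[OF indep A] prob_draw[OF S distr] by (simp add: pmf.rep_eq)
    also have "\<dots> = (\<integral>\<omega>\<in>A. pmf Shat T \<partial>M)"
      using \<open>A \<in> events\<close> by (simp add: set_lebesgue_integral_def)
    finally show "(\<integral>\<omega>\<in>A. ?I T \<omega> \<partial>M) = (\<integral>\<omega>\<in>A. pmf Shat T \<partial>M)" .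
  qed (use intI in auto)
  have "AE \<omega> in M. real_cond_exp M ?F h \<omega> = real_cond_exp M ?F (\<lambda>\<omega>. \<Sum>T\<in>UNIV. g T \<omega> * ?I T \<omega>) \<omega>"
  proof (rule real_cond_exp_cong)
    show "AE \<omega> in M. h \<omega> = (\<Sum>T\<in>UNIV. g T \<omega> * ?I T \<omega>)"
      using h(2) AE_space by eventually_elim (simp only: decomp)
    show "(\<lambda>\<omega>. \<Sum>T\<in>UNIV. g T \<omega> * ?I T \<omega>) \<in> borel_measurable M"
      using int by (intro borel_measurable_sum borel_measurable_integrable)
  qed (rule h(1))
  moreover have "AE \<omega> in M. real_cond_exp M ?F (\<lambda>\<omega>. \<Sum>T\<in>UNIV. g T \<omega> * ?I T \<omega>) \<omega>
      = (\<Sum>T\<in>UNIV. real_cond_exp M ?F (\<lambda>\<omega>. g T \<omega> * ?I T \<omega>) \<omega>)"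
    by (rule real_cond_exp_sum) (rule int)
  moreover have "AE \<omega> in M. \<forall>T\<in>UNIV. real_cond_exp M ?F (\<lambda>\<omega>. g T \<omega> * ?I T \<omega>) \<omega> = g T \<omega> * pmf Shat T"
  proof (rule AE_finite_allI)
    fix T
    have "AE \<omega> in M. real_cond_exp M ?F (\<lambda>\<omega>. g T \<omega> * ?I T \<omega>) \<omega> = g T \<omega> * real_cond_exp M ?F (?I T) \<omega>"
      by (rule real_cond_exp_mult[OF mF _ int]) (use intI in auto)
    with fresh[of T] show "AE \<omega> in M. real_cond_exp M ?F (\<lambda>\<omega>. g T \<omega> * ?I T \<omega>) \<omega> = g T \<omega> * pmf Shat T"
      by eventually_elim simp
  qed simp
  ultimately show ?thesis
    by eventually_elim (simp add: integral_measure_pmf_real[of UNIV])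
qed

text \<open>
  A minimiser of the proximal subproblem of block \<open>i\<close> is only supplied by outcomes that draw \<open>i\<close>;
  this lemma provides such an outcome for almost every past. The set of outcomes whose past admits
  no continuation drawing \<open>i\<close> is an event of the past, and it is disjoint from the event that \<open>i\<close>
  is drawn. As the two are independent and the second has positive probability, the first is null.
\<close>

lemma AE_some_outcome_draws:
  fixes S :: "nat \<Rightarrow> 'a \<Rightarrow> 'n::finite set"
  assumes indep: "indep_vars (\<lambda>_. count_space UNIV) S UNIV"
    and distr: "\<And>j. distr M (count_space UNIV) (S j) = measure_pmf Shat"
    and proper: "sampling_prob Shat $ i > 0"
  shows "AE \<omega> in M. \<exists>\<omega>'\<in>space M. (\<forall>j<k. S j \<omega> = S j \<omega>') \<and> i \<in> S k \<omega>'"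
proof -
  let ?P = "\<lambda>\<omega>. \<exists>\<omega>'\<in>space M. (\<forall>j<k. S j \<omega> = S j \<omega>') \<and> i \<in> S k \<omega>'"
  let ?N = "{\<omega> \<in> space M. \<not> ?P \<omega>}"
  have S: "S j \<in> measurable M (count_space UNIV)" for j
    using indep by (simp add: indep_vars_def2)
  have "depends_on_draws M S k ?P"
    unfolding depends_on_draws_def by metis
  from measurable_sets[OF depends_on_draws_measurable[OF this], of "{False}"]
  have N: "?N \<in> sets (draw_history M S k)"
    by (simp add: space_draw_history vimage_def Int_def conj_commute)
  have "?N \<inter> (S k -` {T. i \<in> T} \<inter> space M) = {}"
    by auto
  with history_indep_draw[OF indep N, of "{T. i \<in> T}"] prob_draw[OF S distr, of k "{T. i \<in> T}"] proper
  have "prob ?N = 0"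
    by (simp add: sampling_prob_def)
  moreover have "?N \<in> events"
    using N subalgebra_draw_history[of S M k, OF S] by (auto simp: subalgebra_def)
  ultimately show ?thesis
    by (intro AE_I[of _ _ ?N]) (auto simp: emeasure_eq_measure)
qed

end

section \<open>Runs of ALPHA\<close>

text \<open>
  The coefficients are designed for this recursion: block by block, \<open>psi_hat\<close> moves from its old
  value towards \<open>\<psi>\<close> at \<open>z k\<close> with step \<open>\<theta> k\<close>, plus the change of \<open>\<psi>\<close> scaled by \<open>\<theta> k / q\<close>. The
  block changes with probability \<open>q\<close>, so on average the last term replaces \<open>\<psi>\<close> at \<open>z k\<close> by \<open>\<psi>\<close> at
  the proximal minimiser.
\<close>

lemma sum_alpha_coeff_Suc:
  "(\<Sum>l\<le>Suc k. alpha_coeff \<theta> q (Suc k) l * r l) =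
     (1 - \<theta> k) * (\<Sum>l\<le>k. alpha_coeff \<theta> q k l * r l) + \<theta> k * r k + \<theta> k / q * (r (Suc k) - r k)"
proof (cases k)
  case 0
  then show ?thesis by (simp add: algebra_simps)
next
  case (Suc j)
  have "(\<Sum>l\<le>Suc k. alpha_coeff \<theta> q (Suc k) l * r l)
      = (\<Sum>l<k. (1 - \<theta> k) * (alpha_coeff \<theta> q k l * r l))
        + ((1 - \<theta> k) * alpha_coeff \<theta> q k k + \<theta> k - \<theta> k / q) * r k + \<theta> k / q * r (Suc k)"
    by (simp add: Suc mult.assoc flip: lessThan_Suc_atMost)
  also have "(\<Sum>l<k. (1 - \<theta> k) * (alpha_coeff \<theta> q k l * r l))
      = (1 - \<theta> k) * ((\<Sum>l\<le>k. alpha_coeff \<theta> q k l * r l) - alpha_coeff \<theta> q k k * r k)"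
    by (simp add: sum_distrib_left right_diff_distrib flip: lessThan_Suc_atMost)
  finally show ?thesis
    by (simp add: algebra_simps)
qed

abbreviation psi_real ::
  "('m::finite \<Rightarrow> 'n::finite) \<Rightarrow> ('n \<Rightarrow> real ^ 'm \<Rightarrow> ereal) \<Rightarrow> real ^ 'm \<Rightarrow> 'n \<Rightarrow> real" where
  "psi_real b \<psi> x i \<equiv> real_of_ereal (\<psi> i (block b i x))"

definition psi_hat_real ::
  "('m::finite \<Rightarrow> 'n::finite) \<Rightarrow> ('n \<Rightarrow> real ^ 'm \<Rightarrow> ereal) \<Rightarrow> real ^ 'n \<Rightarrow> (nat \<Rightarrow> real) \<Rightarrow>
   (nat \<Rightarrow> real ^ 'm) \<Rightarrow> nat \<Rightarrow> 'n \<Rightarrow> real" where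
  "psi_hat_real b \<psi> p \<theta> z k i = (\<Sum>l\<le>k. alpha_coeff \<theta> (p $ i) k l * psi_real b \<psi> (z l) i)"

lemma F_hat_eq_ereal:
  fixes b :: "'m::finite \<Rightarrow> 'n::finite"
  assumes "\<And>l i. \<bar>\<psi> i (block b i (z l))\<bar> \<noteq> \<infinity>"
  shows "F_hat b f \<psi> p \<theta> x z k = ereal ((\<Sum>i\<in>UNIV. psi_hat_real b \<psi> p \<theta> z k i) + f (x k))"
proof -
  have "\<psi> i (block b i (z l)) = ereal (psi_real b \<psi> (z l) i)" for i l
    using assms[of i l] by (simp add: ereal_real)
  then have "psi_hat b \<psi> p \<theta> z k
      = (\<Sum>i\<in>UNIV. \<Sum>l\<le>k. ereal (alpha_coeff \<theta> (p $ i) k l * psi_real b \<psi> (z l) i))"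
    unfolding psi_hat_def times_ereal.simps(1)[symmetric] by simp
  then show ?thesis
    by (simp add: F_hat_def psi_hat_real_def)
qed

lemma alpha_run_step:
  assumes "alpha_run b B f \<psi> p v \<theta> x0 S x y z"
  shows alpha_run_prox: "i \<in> S k \<Longrightarrow> prox_min b B f \<psi> p v (\<theta> k) (x k) (z k) i (block b i (z (Suc k)))"
    and alpha_run_keep: "i \<notin> S k \<Longrightarrow> block b i (z (Suc k)) = block b i (z k)"
    and alpha_run_x: "x (Suc k) = (1 - \<theta> k) *\<^sub>R x k + \<theta> k *\<^sub>R z k
      + \<theta> k *\<^sub>R scale_blocks b (\<chi> i. inverse (p $ i)) (z (Suc k) - z k)"
proof -
  have y: "y k = (1 - \<theta> k) *\<^sub>R x k + \<theta> k *\<^sub>R z k"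
    using assms by (simp add: alpha_run_def)
  show "i \<in> S k \<Longrightarrow> prox_min b B f \<psi> p v (\<theta> k) (x k) (z k) i (block b i (z (Suc k)))"
    and "i \<notin> S k \<Longrightarrow> block b i (z (Suc k)) = block b i (z k)"
    and "x (Suc k) = (1 - \<theta> k) *\<^sub>R x k + \<theta> k *\<^sub>R z k
      + \<theta> k *\<^sub>R scale_blocks b (\<chi> i. inverse (p $ i)) (z (Suc k) - z k)"
    using assms unfolding prox_min_def prox_smooth_def y[symmetric] alpha_run_def by blast+
qed

text \<open>
  A block that is drawn moves to a minimiser of an objective that is finite at the previous iterate,
  so \<open>\<psi>\<close> stays finite along the run and all sums below are sums of reals.
\<close>

lemma alpha_run_psi_finite:
  fixes b :: "'m::finite \<Rightarrow> 'n::finite"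
  assumes run: "alpha_run b B f \<psi> p v \<theta> x0 S x y z"
    and psi: "\<And>i u. u \<in> block_space b i \<Longrightarrow> \<psi> i u \<noteq> -\<infinity>"
    and x0: "x0 \<in> ext_dom (separable_sum b \<psi>)"
  shows "\<bar>\<psi> i (block b i (z k))\<bar> \<noteq> \<infinity>"
proof (induction k arbitrary: i)
  case 0
  have "\<psi> i (block b i x0) \<noteq> \<infinity>"
    using x0 by (auto simp: ext_dom_def separable_sum_def sum_Pinfty)
  moreover have "z 0 = x0"
    using run by (simp add: alpha_run_def)
  ultimately show ?case
    using psi[OF block_in_space, of i x0] by auto
next
  case (Suc k)
  show ?case
  proof (cases "i \<in> S k")
    case True
    show ?thesis
    proof (rule arg_min_finite[OF alpha_run_prox[OF run True, unfolded prox_min_def]])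
      show "\<psi> i (block b i (z k)) < \<infinity>"
        using Suc.IH[of i] by auto
    qed (intro block_in_space psi)+
  next
    case False
    with Suc.IH[of i] show ?thesis
      by (simp add: alpha_run_keep[OF run])
  qed
qed

text \<open>
  Strong convexity makes the proximal minimiser unique, so a run is a function of the sets drawn
  even though it is described only by the property of being a minimiser.
\<close>

lemma alpha_run_determined:
  fixes b :: "'m::finite \<Rightarrow> 'n::finite"
  assumes run: "alpha_run b B f \<psi> p v \<theta> x0 S x y z" "alpha_run b B f \<psi> p v \<theta> x0 S' x' y' z'"
    and psi: "\<And>i u. u \<in> block_space b i \<Longrightarrow> \<psi> i u \<noteq> -\<infinity>"
    and psi_convex: "\<And>i. ext_convex_on (block_space b i) (\<psi> i)"
    and x0: "x0 \<in> ext_dom (separable_sum b \<psi>)"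
    and B: "\<And>i. sym_pos_def_on_block b i (B i)"
    and pos: "\<And>i. v $ i > 0" "\<And>i. p $ i > 0" "\<And>j. \<theta> j > 0"
    and same: "\<And>j. j < k \<Longrightarrow> S j = S' j" and "l \<le> k"
  shows "x l = x' l \<and> z l = z' l"
  using \<open>l \<le> k\<close>
proof (induction l)
  case 0
  show ?case
    using run by (simp add: alpha_run_def)
next
  case (Suc l)
  then have eq: "x l = x' l" "z l = z' l" "S l = S' l"
    using same by auto
  have "block b i (z (Suc l)) = block b i (z' (Suc l))" for i
  proof (cases "i \<in> S l")
    case True
    show ?thesis
      by (rule prox_min_unique[OF alpha_run_prox[OF run(1) True]])
        (use alpha_run_prox[OF run(2), of i l] True eq psi_convex B pos alpha_run_psi_finite[OF run(1) psi x0]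
          alpha_run_psi_finite[OF run(2) psi x0] in auto)
  next
    case False
    then show ?thesis
      using eq alpha_run_keep[OF run(1)] alpha_run_keep[OF run(2)] by simp
  qed
  then have "z (Suc l) = z' (Suc l)"
    by (rule vec_eq_blockI)
  with eq show ?case
    by (simp add: alpha_run_x[OF run(1)] alpha_run_x[OF run(2)])
qed

text \<open>
  By uniqueness of the minimisers, the drawn blocks of the next \<open>z\<close> are the blocks of any \<open>u\<close> that
  solves all subproblems at once; the run thus takes the step described by \<open>step_value\<close>.
\<close>

lemma alpha_run_step_value:
  fixes b :: "'m::finite \<Rightarrow> 'n::finite"
  assumes run: "alpha_run b B f \<psi> p v \<theta> x0 S x y' z"
    and psi: "\<And>i u. u \<in> block_space b i \<Longrightarrow> \<psi> i u \<noteq> -\<infinity>"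
    and psi_convex: "\<And>i. ext_convex_on (block_space b i) (\<psi> i)"
    and x0: "x0 \<in> ext_dom (separable_sum b \<psi>)"
    and B: "\<And>i. sym_pos_def_on_block b i (B i)"
    and pos: "\<And>i. v $ i > 0" "\<And>i. p $ i > 0" "\<And>j. \<theta> j > 0"
    and u: "\<And>i. prox_min b B f \<psi> p v (\<theta> k) (x k) (z k) i (block b i u)"
    and u_fin: "\<And>i. \<bar>\<psi> i (block b i u)\<bar> \<noteq> \<infinity>"
  shows "real_of_ereal (F_hat b f \<psi> p \<theta> x z (Suc k))
      + (\<theta> k)\<^sup>2 / 2 * weighted_norm2 b B (\<chi> i. v $ i / (p $ i)\<^sup>2) (z (Suc k) - y)
    = step_value b B f p v (\<theta> k) y (psi_hat_real b \<psi> p \<theta> z k) (psi_real b \<psi> (z k))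
        (psi_real b \<psi> u) (x k) (z k) u (S k)"
proof -
  have fin: "\<bar>\<psi> i (block b i (z l))\<bar> \<noteq> \<infinity>" for i l
    using alpha_run_psi_finite[OF run psi x0] .
  have F_hat: "F_hat b f \<psi> p \<theta> x z (Suc k)
      = ereal ((\<Sum>i\<in>UNIV. psi_hat_real b \<psi> p \<theta> z (Suc k) i) + f (x (Suc k)))"
    by (rule F_hat_eq_ereal) (rule fin)
  have block_z: "block b i (z (Suc k)) = (if i \<in> S k then block b i u else block b i (z k))" for i
  proof (cases "i \<in> S k")
    case True
    have "block b i (z (Suc k)) = block b i u"
      by (rule prox_min_unique[OF alpha_run_prox[OF run True] u psi_convex fin u_fin]) (use pos B in auto)
    with True show ?thesis by simp
  qed (simp add: alpha_run_keep[OF run])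
  have z: "z (Suc k) = z k + restrict_blocks b (S k) (u - z k)"
    by (rule vec_eq_blockI[where b = b]) (simp add: block_z block_add block_diff block_restrict_blocks)
  have x: "x (Suc k) = (1 - \<theta> k) *\<^sub>R x k + \<theta> k *\<^sub>R z k
      + restrict_blocks b (S k) (\<theta> k *\<^sub>R scale_blocks b (\<chi> i. inverse (p $ i)) (u - z k))"
  proof -
    have "\<theta> k *\<^sub>R scale_blocks b (\<chi> i. inverse (p $ i)) (z (Suc k) - z k)
        = restrict_blocks b (S k) (\<theta> k *\<^sub>R scale_blocks b (\<chi> i. inverse (p $ i)) (u - z k))"
      by (rule vec_eq_blockI[where b = b])
        (simp add: block_z block_scaleR block_scale_blocks block_diff block_restrict_blocks)
    then show ?thesis
      by (simp only: alpha_run_x[OF run])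
  qed
  have "psi_hat_real b \<psi> p \<theta> z (Suc k) i
      = (1 - \<theta> k) * psi_hat_real b \<psi> p \<theta> z k i + \<theta> k * psi_real b \<psi> (z k) i
        + \<theta> k / p $ i * ((if i \<in> S k then psi_real b \<psi> u i else psi_real b \<psi> (z k) i) - psi_real b \<psi> (z k) i)" for i
    unfolding psi_hat_real_def sum_alpha_coeff_Suc by (simp add: block_z)
  then show ?thesis
    unfolding F_hat step_value_def z[symmetric] x[symmetric] by simp
qed

section \<open>The expected decrease\<close>

theorem lemma6:
  fixes b :: "'m::finite \<Rightarrow> 'n::finite"
    and B :: "'n \<Rightarrow> real ^ 'm ^ 'm"
    and f :: "real ^ 'm \<Rightarrow> real"
    and \<psi> :: "'n \<Rightarrow> real ^ 'm \<Rightarrow> ereal"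
    and Shat :: "'n set pmf"
    and p v :: "real ^ 'n"
    and \<theta> :: "nat \<Rightarrow> real"
    and M :: "'w measure"
    and S :: "nat \<Rightarrow> 'w \<Rightarrow> 'n set"
    and x0 :: "real ^ 'm"
    and xs ys zs :: "nat \<Rightarrow> 'w \<Rightarrow> real ^ 'm"
    and Fh :: "nat \<Rightarrow> 'w \<Rightarrow> ereal"
    and dist2 :: "nat \<Rightarrow> 'w \<Rightarrow> real"
    and y :: "real ^ 'm"
    and k :: nat
  defines "p \<equiv> sampling_prob Shat"
    and "Fh \<equiv> (\<lambda>j \<omega>. F_hat b f \<psi> p \<theta> (\<lambda>l. xs l \<omega>) (\<lambda>l. zs l \<omega>) j)"
    and "dist2 \<equiv> (\<lambda>j \<omega>. weighted_norm2 b B (\<chi> i. v $ i / (p $ i)\<^sup>2) (zs j \<omega> - y))"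
  assumes B: "\<And>i. sym_pos_def_on_block b i (B i)"
    and f_convex: "convex_on UNIV f"
    and f_diff: "\<And>x. f differentiable (at x)"
    and psi_gt_minf: "\<And>i u. u \<in> block_space b i \<Longrightarrow> \<psi> i u \<noteq> -\<infinity>"
    and psi_convex: "\<And>i. ext_convex_on (block_space b i) (\<psi> i)"
    and psi_closed: "\<And>i. ext_closed_on (block_space b i) (\<psi> i)"
    and proper: "proper_sampling Shat"
    and v_pos: "\<And>i. v $ i > 0"
    and eso: "ESO b B f Shat v"
    and theta: "\<And>j. 0 < \<theta> j \<and> \<theta> j \<le> 1"
    and M: "prob_space M"
    and S_indep: "prob_space.indep_vars M (\<lambda>_. count_space UNIV) S UNIV"
    and S_distr: "\<And>j. distr M (count_space UNIV) (S j) = measure_pmf Shat"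
    and x0: "x0 \<in> ext_dom (separable_sum b \<psi>)"
    and run: "\<And>\<omega>. \<omega> \<in> space M \<Longrightarrow>
      alpha_run b B f \<psi> p v \<theta> x0 (\<lambda>j. S j \<omega>) (\<lambda>j. xs j \<omega>) (\<lambda>j. ys j \<omega>) (\<lambda>j. zs j \<omega>)"
  shows "(\<forall>j. \<forall>\<omega>\<in>space M. \<bar>Fh j \<omega>\<bar> \<noteq> \<infinity>) \<and>
    integrable M (\<lambda>\<omega>. real_of_ereal (Fh (Suc k) \<omega>) + (\<theta> k)\<^sup>2 / 2 * dist2 (Suc k) \<omega>) \<and>
    (AE \<omega> in M.
      ereal (real_cond_exp M (draw_history M S k)
        (\<lambda>\<omega>. real_of_ereal (Fh (Suc k) \<omega>) + (\<theta> k)\<^sup>2 / 2 * dist2 (Suc k) \<omega>) \<omega>)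
      \<le> (Fh k \<omega> + ereal ((\<theta> k)\<^sup>2 / 2 * dist2 k \<omega>))
          - ereal (\<theta> k) * (Fh k \<omega> - (ereal (f y) + separable_sum b \<psi> y)))"
proof -
  interpret prob_space M by (rule M)
  have p_pos: "p $ i > 0" for i
    using proper by (simp add: proper_sampling_def p_def)
  have S: "S j \<in> measurable M (count_space UNIV)" for j
    using S_indep by (simp add: indep_vars_def2)
  have fin: "\<bar>\<psi> i (block b i (zs l \<omega>))\<bar> \<noteq> \<infinity>" if "\<omega> \<in> space M" for i l \<omega>
    using alpha_run_psi_finite[OF run[OF that] psi_gt_minf x0] .
  let ?A = "\<lambda>k \<omega>. psi_hat_real b \<psi> p \<theta> (\<lambda>l. zs l \<omega>) k"
  let ?h = "\<lambda>\<omega>. real_of_ereal (Fh (Suc k) \<omega>) + (\<theta> k)\<^sup>2 / 2 * dist2 (Suc k) \<omega>"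
  have Fh: "Fh j \<omega> = ereal ((\<Sum>i\<in>UNIV. ?A j \<omega> i) + f (xs j \<omega>))" if "\<omega> \<in> space M" for j \<omega>
    unfolding Fh_def by (rule F_hat_eq_ereal) (rule fin[OF that])
  have iterates: "xs l \<omega> = xs l \<omega>' \<and> zs l \<omega> = zs l \<omega>'"
    if "\<omega> \<in> space M" "\<omega>' \<in> space M" "\<forall>j<n. S j \<omega> = S j \<omega>'" "l \<le> n" for l n \<omega> \<omega>'
    using alpha_run_determined[OF run[OF that(1)] run[OF that(2)] psi_gt_minf psi_convex x0 B]
      v_pos p_pos theta that(3,4) by blast
  have A_eq: "?A n \<omega> = ?A n \<omega>'"
    if "\<omega> \<in> space M" "\<omega>' \<in> space M" "\<forall>j<n. S j \<omega> = S j \<omega>'" for n \<omega> \<omega>'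
    unfolding psi_hat_real_def
    by (intro ext sum.cong refl) (use iterates[OF that] in simp)

  have dep_h: "depends_on_draws M S (Suc k) ?h"
    unfolding depends_on_draws_def
  proof (intro ballI impI)
    fix \<omega> \<omega>' assume *: "\<omega> \<in> space M" "\<omega>' \<in> space M" "\<forall>j<Suc k. S j \<omega> = S j \<omega>'"
    show "?h \<omega> = ?h \<omega>'"
      using iterates[OF * order_refl] A_eq[OF *] * by (simp add: Fh dist2_def)
  qed
  have int_h: "integrable M ?h"
    by (rule depends_on_draws_integrable[OF S dep_h])

  \<comment> \<open>A choice of \<open>u\<close> that looks at \<open>\<omega>\<close> only through the current iterates, so that it depends on the past alone.\<close>
  define u where "u \<omega> = (SOME u. \<forall>i. prox_min b B f \<psi> p v (\<theta> k) (xs k \<omega>) (zs k \<omega>) i (block b i u))" for \<omega>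
  have "AE \<omega> in M. \<forall>i\<in>UNIV. \<exists>\<omega>'\<in>space M. (\<forall>j<k. S j \<omega> = S j \<omega>') \<and> i \<in> S k \<omega>'"
    by (rule AE_finite_allI, simp)
      (rule AE_some_outcome_draws[OF S_indep S_distr], use p_pos in \<open>simp add: p_def\<close>)
  then have u: "AE \<omega> in M. \<forall>i. prox_min b B f \<psi> p v (\<theta> k) (xs k \<omega>) (zs k \<omega>) i (block b i (u \<omega>))"
    using AE_space
  proof eventually_elim
    case (elim \<omega>)
    then obtain w where w: "w i \<in> space M" "\<forall>j<k. S j \<omega> = S j (w i)" "i \<in> S k (w i)" for i
      by (metis UNIV_I)
    \<comment> \<open>The outcome \<open>w i\<close> has the same iterates up to step \<open>k\<close>, and its next iterate solves the subproblem of block \<open>i\<close>.\<close>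
    have "prox_min b B f \<psi> p v (\<theta> k) (xs k \<omega>) (zs k \<omega>) i (block b i (zs (Suc k) (w i)))" for i
      using alpha_run_prox[OF run[OF w(1)] w(3)] iterates[OF elim(2) w(1) w(2) order_refl] by simp
    then have "\<exists>u. \<forall>i. prox_min b B f \<psi> p v (\<theta> k) (xs k \<omega>) (zs k \<omega>) i (block b i u)"
      by (intro exI[of _ "\<Sum>i\<in>UNIV. block b i (zs (Suc k) (w i))"])
        (simp add: block_sum_blocks[OF block_in_space])
    then show ?case
      unfolding u_def by (rule someI_ex)
  qed
  have u_fin: "\<bar>\<psi> i (block b i (u \<omega>))\<bar> \<noteq> \<infinity>"
    if "\<omega> \<in> space M" "\<forall>i. prox_min b B f \<psi> p v (\<theta> k) (xs k \<omega>) (zs k \<omega>) i (block b i (u \<omega>))" for i \<omega>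
    by (rule arg_min_finite[OF that(2)[rule_format, unfolded prox_min_def] block_in_space[of b i "zs k \<omega>"]])
      (use fin[OF that(1), of i k] psi_gt_minf[OF block_in_space] in auto)

  define g where "g T \<omega> = step_value b B f p v (\<theta> k) y (?A k \<omega>) (psi_real b \<psi> (zs k \<omega>))
    (psi_real b \<psi> (u \<omega>)) (xs k \<omega>) (zs k \<omega>) (u \<omega>) T" for T \<omega>
  have dep_g: "depends_on_draws M S k (g T)" for T
    unfolding depends_on_draws_def
  proof (intro ballI impI)
    fix \<omega> \<omega>' assume *: "\<omega> \<in> space M" "\<omega>' \<in> space M" "\<forall>j<k. S j \<omega> = S j \<omega>'"
    show "g T \<omega> = g T \<omega>'"
      using iterates[OF * order_refl] A_eq[OF *] by (simp add: g_def u_def)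
  qed
  have "AE \<omega> in M. ?h \<omega> = g (S k \<omega>) \<omega>"
    using u AE_space
  proof eventually_elim
    case (elim \<omega>)
    show ?case
      unfolding Fh_def dist2_def g_def
      by (rule alpha_run_step_value[OF run[OF elim(2)] psi_gt_minf psi_convex x0 B])
        (use v_pos p_pos theta elim u_fin in auto)
  qed
  from cond_exp_fresh_draw[OF S_indep S_distr dep_g borel_measurable_integrable[OF int_h] this]
  have "AE \<omega> in M. ereal (real_cond_exp M (draw_history M S k) ?h \<omega>)
      \<le> (Fh k \<omega> + ereal ((\<theta> k)\<^sup>2 / 2 * dist2 k \<omega>))
          - ereal (\<theta> k) * (Fh k \<omega> - (ereal (f y) + separable_sum b \<psi> y))"
    using u AE_space
  proof eventually_elim
    case (elim \<omega>)
    show ?case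
    proof (cases "\<exists>i. \<psi> i (block b i y) = \<infinity>")
      case True
      \<comment> \<open>Outside the domain of \<open>\<psi>\<close> the right-hand side is infinite.\<close>
      then have "separable_sum b \<psi> y = \<infinity>"
        by (auto simp: separable_sum_def sum_Pinfty)
      then show ?thesis
        using theta[of k] by (simp add: Fh[OF elim(3)])
    next
      case False
      then have q: "\<psi> i (block b i y) = ereal (psi_real b \<psi> y i)" for i
        using psi_gt_minf[OF block_in_space, of i y] by (cases "\<psi> i (block b i y)") auto
      have "measure_pmf.expectation Shat (\<lambda>T. g T \<omega>)
        \<le> (1 - \<theta> k) * ((\<Sum>i\<in>UNIV. ?A k \<omega> i) + f (xs k \<omega>)) + \<theta> k * (f y + (\<Sum>i\<in>UNIV. psi_real b \<psi> y i))
          + (\<theta> k)\<^sup>2 / 2 * dist2 k \<omega>"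
        unfolding g_def dist2_def p_def
      proof (rule expectation_step_value[OF f_convex f_diff psi_convex _ eso _ _ _ _ q])
        show "\<psi> i (block b i (u \<omega>)) = ereal (psi_real b \<psi> (u \<omega>) i)" for i
          using u_fin[OF elim(3,2)] by (simp add: ereal_real)
      qed (use p_pos theta elim in \<open>auto simp: p_def\<close>)
      then have "real_cond_exp M (draw_history M S k) ?h \<omega>
        \<le> (1 - \<theta> k) * ((\<Sum>i\<in>UNIV. ?A k \<omega> i) + f (xs k \<omega>)) + \<theta> k * (f y + (\<Sum>i\<in>UNIV. psi_real b \<psi> y i))
          + (\<theta> k)\<^sup>2 / 2 * dist2 k \<omega>"
        by (simp only: elim(1))
      moreover have "separable_sum b \<psi> y = ereal (\<Sum>i\<in>UNIV. psi_real b \<psi> y i)"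
        unfolding separable_sum_def sum_ereal[symmetric] by (intro sum.cong refl q)
      ultimately show ?thesis
        by (simp add: Fh[OF elim(3)] algebra_simps)
    qed
  qed
  moreover have "\<forall>j. \<forall>\<omega>\<in>space M. \<bar>Fh j \<omega>\<bar> \<noteq> \<infinity>"
    by (simp add: Fh)
  ultimately show ?thesis
    using int_h by blast
qed

end
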